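(* For every integer $N\ge 3$, the $0$-th rhythm polynomial $Bav_N^0:\mathbf{F}_2^N\to\mathbf{F}_2$ is balanced, i.e. $|(Bav_N^0)^{-1}(\{0\})|=|(Bav_N^0)^{-1}(\{1\})|=2^{N-1}$.
   Context: Let $N\ge 3$ and $\mathbf{Z}_N=\{0,1,\dots,N-1\}$. For an integer $m$, $\langle m\rangle_N\in\mathbf{Z}_N$ is its least nonnegative remainder modulo $N$; $a+_Nb=\langle a+b\rangle_N$, $a-_Nb=\langle a-b\rangle_N$. For $a,b\in\mathbf{Z}_N$ put $av_{\mathbf{Z}_N}(a,b)=a+_N\left\lfloor\frac{b-_Na}{2}\right\rfloor$. Boolean average. For $\mathbf{v}=(v_0,\dots,v_{N-1})\in\mathbf{F}_2^N$ let $a_0<a_1<\dots<a_{n-1}$ be the elements of $\{i\in\mathbf{Z}_N: v_i=1\}$ in increasing order. $Bav(\mathbf{v})\in\mathbf{F}_2^N$ is the vector whose $i$-th coordinate is $1$ exactly when $i=av_{\mathbf{Z}_N}(a_k,a_{k+1})$ for some $0\le k\le n-1$, where $a_n:=a_0$ (so $Bav(\mathbf 0)=\mathbf 0$, and $Bav(\mathbf v)=\mathbf v$ if $n=1$). $Bav_N^0(\mathbf{v})\in\mathbf{F}_2$ denotes the $0$-th coordinate of $Bav(\mathbf{v})$; it is called the $0$-th rhythm polynomial modulo $N$. *)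

theory Defs
  imports Main "HOL-Library.FuncSet" "HOL-Library.Z2"
begin

definition ZN :: "nat \<Rightarrow> nat set" where
  "ZN N = {0..<N}"

definition rem_mod :: "nat \<Rightarrow> int \<Rightarrow> nat" where
  "rem_mod N m = nat (m mod int N)"

definition add_mod :: "nat \<Rightarrow> nat \<Rightarrow> nat \<Rightarrow> nat" where
  "add_mod N a b = rem_mod N (int a + int b)"

definition sub_mod :: "nat \<Rightarrow> nat \<Rightarrow> nat \<Rightarrow> nat" where
  "sub_mod N a b = rem_mod N (int a - int b)"

definition av :: "nat \<Rightarrow> nat \<Rightarrow> nat \<Rightarrow> nat" where
  "av N a b = add_mod N a (sub_mod N b a div 2)"

text \<open>The type \<^typ>\<open>bit\<close> is the field with two elements. The vector space of dimension
  \<open>N\<close> over it consists of the functions on \<open>ZN N\<close>, represented extensionally (value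
  \<^const>\<open>undefined\<close> off \<open>ZN N\<close>), so that distinct functions are distinct vectors.\<close>

definition F2_vec :: "nat \<Rightarrow> (nat \<Rightarrow> bit) set" where
  "F2_vec N = ZN N \<rightarrow>\<^sub>E UNIV"

definition supp :: "nat \<Rightarrow> (nat \<Rightarrow> bit) \<Rightarrow> nat set" where
  "supp N v = {i \<in> ZN N. v i = 1}"

text \<open>The element \<open>a\<^sub>k\<close> of the increasing enumeration of the support, with the cyclic
  convention \<open>a\<^sub>n = a\<^sub>0\<close>, where \<open>n\<close> is the size of the support; only indices
  \<open>k \<le> n\<close> with \<open>n > 0\<close> are meaningful.\<close>

definition supp_nth :: "nat \<Rightarrow> (nat \<Rightarrow> bit) \<Rightarrow> nat \<Rightarrow> nat" where
  "supp_nth N v k =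
     sorted_list_of_set (supp N v) ! (if k = card (supp N v) then 0 else k)"

definition Bav :: "nat \<Rightarrow> (nat \<Rightarrow> bit) \<Rightarrow> (nat \<Rightarrow> bit)" where
  "Bav N v = (\<lambda>i\<in>ZN N.
     if \<exists>k<card (supp N v). i = av N (supp_nth N v k) (supp_nth N v (k + 1)) then 1 else 0)"

definition Bav0 :: "nat \<Rightarrow> (nat \<Rightarrow> bit) \<Rightarrow> bit" where
  "Bav0 N v = Bav N v 0"

definition balanced :: "nat \<Rightarrow> ((nat \<Rightarrow> bit) \<Rightarrow> bit) \<Rightarrow> bool" where
  "balanced N f \<longleftrightarrow>
     card {v \<in> F2_vec N. f v = 0} = 2 ^ (N - 1) \<and>
     card {v \<in> F2_vec N. f v = 1} = 2 ^ (N - 1)"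

end

theory Submission imports Defs begin

text \<open>Identify a vector with its support \<open>S\<close>. The average of two cyclically consecutive elements of
  \<open>S\<close> is \<open>0\<close> in exactly three disjoint situations: \<open>0, 1 \<in> S\<close>; or \<open>S = {0}\<close>; or the step that
  wraps around from \<open>Max S\<close> to \<open>Min S\<close> averages to \<open>0\<close>, which means
  \<open>Min S + Max S \<in> {N, N + 1}\<close> with \<open>Min S < Max S\<close>. The first situation accounts for
  \<open>2 ^ (N - 2)\<close> sets. In the third one \<open>Max S - Min S\<close> takes every value \<open>t\<close> from \<open>1\<close> to \<open>N - 2\<close>,
  determines both extremes, and leaves \<open>2 ^ (t - 1)\<close> choices; these add up to \<open>2 ^ (N - 2) - 1\<close>.\<close>

section \<open>Vectors as subsets of \<open>{..<N}\<close>\<close>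

text \<open>Injectivity rests on extensionality: members of \<open>F2_vec N\<close> agree off
  \<open>ZN N\<close>, and a \<open>bit\<close> other than 1 is 0.\<close>

lemma bij_betw_supp: "bij_betw (supp N) (F2_vec N) (Pow {..<N})"
proof (rule bij_betwI[where g = "\<lambda>S. \<lambda>i\<in>ZN N. if i \<in> S then 1 else 0"])
  show "(\<lambda>S. \<lambda>i\<in>ZN N. if i \<in> S then 1 else 0) \<in> Pow {..<N} \<rightarrow> F2_vec N"
    by (auto simp: F2_vec_def)
  show "supp N \<in> F2_vec N \<rightarrow> Pow {..<N}"
    by (auto simp: supp_def ZN_def)
  show "(\<lambda>i\<in>ZN N. if i \<in> supp N v then 1 else 0) = v" if "v \<in> F2_vec N" for v
  proof
    fix i
    show "(\<lambda>i\<in>ZN N. if i \<in> supp N v then 1 else 0) i = v i"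
      using that PiE_arb[of v "ZN N" "\<lambda>_. UNIV" i]
      by (cases "v i") (auto simp: F2_vec_def supp_def restrict_def)
  qed
  show "supp N (\<lambda>i\<in>ZN N. if i \<in> S then 1 else 0) = S" if "S \<in> Pow {..<N}" for S
    using that by (auto simp: supp_def ZN_def split: if_splits)
qed

lemma card_F2_vec_supp:
  "card {v \<in> F2_vec N. P (supp N v)} = card {S. S \<subseteq> {..<N} \<and> P S}"
proof -
  have "{S. S \<subseteq> {..<N} \<and> P S} = {S \<in> supp N ` F2_vec N. P S}"
    unfolding bij_betw_imp_surj_on[OF bij_betw_supp] by simp
  also have "\<dots> = supp N ` {v \<in> F2_vec N. P (supp N v)}"
    by auto
  finally have "supp N ` {v \<in> F2_vec N. P (supp N v)} = {S. S \<subseteq> {..<N} \<and> P S}" ..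
  moreover have "inj_on (supp N) {v \<in> F2_vec N. P (supp N v)}"
    by (rule inj_on_subset[OF bij_betw_imp_inj_on[OF bij_betw_supp]]) auto
  ultimately show ?thesis
    using card_image by fastforce
qed

section \<open>Counting sets with prescribed extremes\<close>

lemma card_between_sets:
  assumes "finite A" "B \<subseteq> A"
  shows "card {S. B \<subseteq> S \<and> S \<subseteq> A} = 2 ^ card (A - B)"
proof -
  have "bij_betw (\<lambda>T. T \<union> B) (Pow (A - B)) {S. B \<subseteq> S \<and> S \<subseteq> A}"
    by (rule bij_betwI[where g = "\<lambda>S. S - B"]) (use assms(2) in auto)
  then show ?thesis
    using assms(1) by (simp add: card_Pow flip: bij_betw_same_card)
qed

lemma sets_with_Min_Max:
  fixes a b :: "'a :: linorder"
  shows "{S. finite S \<and> S \<noteq> {} \<and> Min S = b \<and> Max S = a} = {S. finite S \<and> {b, a} \<subseteq> S \<and> S \<subseteq> {b..a}}"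
proof -
  have "S \<noteq> {} \<and> Min S = b \<and> Max S = a \<longleftrightarrow> {b, a} \<subseteq> S \<and> S \<subseteq> {b..a}" if "finite S" for S
  proof (cases "S = {}")
    case False
    show ?thesis
      unfolding Min_eq_iff[OF that False] Max_eq_iff[OF that False] using False by auto
  qed auto
  then show ?thesis
    by blast
qed

text \<open>Both extremes are forced into the set, and the \<open>a - b - 1\<close> numbers strictly
  between them are free.\<close>

lemma card_sets_with_Min_Max:
  fixes a b :: nat
  assumes "b < a"
  shows "card {S. finite S \<and> S \<noteq> {} \<and> Min S = b \<and> Max S = a} = 2 ^ (a - b - 1)"
proof -
  have "{S. finite S \<and> S \<noteq> {} \<and> Min S = b \<and> Max S = a} = {S. {b, a} \<subseteq> S \<and> S \<subseteq> {b..a}}"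
    using assms sets_with_Min_Max[of b a] finite_subset[of _ "{b..a}"] by auto
  moreover have "card {S. {b, a} \<subseteq> S \<and> S \<subseteq> {b..a}} = 2 ^ card ({b..a} - {b, a})"
    by (rule card_between_sets) (use assms in auto)
  moreover have "card ({b..a} - {b, a}) = a - b - 1"
    using assms by (subst card_Diff_subset) auto
  ultimately show ?thesis
    by simp
qed

section \<open>Cyclic neighbours in a finite linear order\<close>

text \<open>Trades list indices for order conditions: a step upwards skips no element, and the one
  remaining step leads from \<open>Max A\<close> to \<open>Min A\<close>. A singleton falls under
  the latter with \<open>a = b\<close>.\<close>

lemma cyclically_consecutive_iff:
  fixes A :: "'a :: linorder set"
  assumes "finite A"
  defines "xs \<equiv> sorted_list_of_set A"
  shows "(\<exists>k<card A. a = xs ! k \<and> b = xs ! (if k + 1 = card A then 0 else k + 1)) \<longleftrightarrow>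
    a \<in> A \<and> b \<in> A \<and> (a < b \<and> A \<inter> {a<..<b} = {} \<or> a = Max A \<and> b = Min A)"
    (is "?L \<longleftrightarrow> ?R")
proof -
  have len: "length xs = card A" and set: "set xs = A"
    using assms by auto
  have less_iff: "xs ! i < xs ! j \<longleftrightarrow> i < j" if "i < card A" "j < card A" for i j
    using that sorted_wrt_nth_less[of "(<)" xs] len
    by (metis xs_def strict_sorted_list_of_set linorder_neqE less_asym less_irrefl)
  have mem: "xs ! i \<in> A" if "i < card A" for i
    using that len set nth_mem by fastforce
  have ex: "\<exists>i<card A. x = xs ! i" if "x \<in> A" for x
    using that len set by (metis in_set_conv_nth)
  have Max: "Max A = xs ! (card A - 1)" and Min: "Min A = xs ! 0" if "A \<noteq> {}"
  proof -
    have pos: "card A > 0"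
      using that assms(1) by (simp add: card_gt_0_iff)
    show "Max A = xs ! (card A - 1)"
    proof (rule Max_eqI[OF assms(1)])
      show "y \<le> xs ! (card A - 1)" if "y \<in> A" for y
        using ex[OF that] pos less_iff[of "card A - 1"] by (metis diff_less less_one not_less
            nat_less_le not_less_eq Suc_diff_1)
    qed (use pos mem in auto)
    show "Min A = xs ! 0"
    proof (rule Min_eqI[OF assms(1)])
      show "xs ! 0 \<le> y" if "y \<in> A" for y
        using ex[OF that] pos less_iff[of _ 0] by (metis not_less less_nat_zero_code)
    qed (use pos mem in auto)
  qed
  show ?thesis
  proof
    assume ?L
    then obtain k where k: "k < card A" "a = xs ! k"
      and b: "b = xs ! (if k + 1 = card A then 0 else k + 1)"
      by blast
    have "A \<noteq> {}"
      using k by auto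
    show ?R
    proof (cases "k + 1 = card A")
      case True
      then show ?thesis
        using k b Max[OF \<open>A \<noteq> {}\<close>] Min[OF \<open>A \<noteq> {}\<close>] mem[of k] mem[of 0]
        by (auto simp flip: True)
    next
      case False
      then have k': "k + 1 < card A"
        using k by auto
      have "x \<notin> {a<..<b}" if "x \<in> A" for x
        using ex[OF that] k k' b less_iff by auto
      then show ?thesis
        using k k' b mem[of k] mem[of "k + 1"] less_iff[of k "k + 1"] by auto
    qed
  next
    assume R: ?R
    then obtain i j where ij: "i < card A" "a = xs ! i" "j < card A" "b = xs ! j"
      using ex by blast
    from R consider "a < b" "A \<inter> {a<..<b} = {}" | "a = Max A" "b = Min A" "A \<noteq> {}"
      by blast
    then show ?L
    proof cases
      case 1
      then have "i < j"
        using ij less_iff by auto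
      \<comment> \<open>Otherwise \<open>xs ! (i + 1)\<close> would lie strictly between
        \<open>a\<close> and \<open>b\<close>.\<close>
      moreover have "\<not> i + 1 < j"
        using 1(2) ij mem[of "i + 1"] less_iff[of i "i + 1"] less_iff[of "i + 1" j] by auto
      ultimately have "j = i + 1"
        by auto
      then show ?thesis
        using ij by auto
    next
      case 2
      then show ?thesis
        using ij Max Min by (intro exI[of _ "card A - 1"]) auto
    qed
  qed
qed

section \<open>Closed forms for the cyclic average\<close>

lemma av_nowrap:
  assumes "a \<le> b" "b < N"
  shows "av N a b = (a + b) div 2"
proof -
  have sub: "sub_mod N b a = b - a"
    using assms by (simp add: sub_mod_def rem_mod_def flip: of_nat_diff)
  \<comment> \<open>The even summand \<open>2 * a\<close> can be pulled out of the floor.\<close>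
  have "(a + b) div 2 = (2 * a + (b - a)) div 2"
    using assms(1) by simp
  then have "a + (b - a) div 2 = (a + b) div 2"
    by simp
  then have "av N a b = (a + b) div 2 mod N"
    by (simp add: av_def sub add_mod_def rem_mod_def nat_mod_distrib flip: of_nat_add zmod_int)
  then show ?thesis
    using assms by simp
qed

text \<open>Going up from \<open>a\<close> to the smaller \<open>b\<close> passes \<open>N\<close>,
  so \<open>b + N\<close> takes the place of \<open>b\<close>; the midpoint can reach
  \<open>N\<close>, hence the remaining \<open>mod N\<close>.\<close>

lemma av_wrap:
  assumes "b < a" "a < N"
  shows "av N a b = (a + b + N) div 2 mod N"
proof -
  have "(int b - int a) mod int N = (int b - int a + int N) mod int N"
    by simp
  also have "\<dots> = int b - int a + int N"
    using assms by (intro mod_pos_pos_trivial) auto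
  finally have sub: "sub_mod N b a = b + N - a"
    using assms by (simp add: sub_mod_def rem_mod_def)
  have "(a + b + N) div 2 = (2 * a + (b + N - a)) div 2"
    using assms by simp
  then have "a + (b + N - a) div 2 = (a + b + N) div 2"
    by simp
  then show ?thesis
    by (simp add: av_def sub add_mod_def rem_mod_def flip: of_nat_add zmod_int)
qed

text \<open>The unreduced midpoint lies strictly between 0 and \<open>2 * N\<close>, so it must be
  \<open>N\<close>; the floor admits two values of \<open>a + b\<close>.\<close>

lemma av_wrap_eq_0_iff:
  assumes "b < a" "a < N"
  shows "av N a b = 0 \<longleftrightarrow> a + b \<in> {N, N + 1}"
proof -
  define m where "m = (a + b + N) div 2"
  have m: "0 < m" "m < 2 * N"
    using assms by (auto simp: m_def)
  have "m mod N = 0 \<longleftrightarrow> m = N"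
  proof
    assume "m mod N = 0"
    then obtain q where q: "m = N * q"
      by blast
    then have "q = 1"
      using m by (cases q) auto
    then show "m = N"
      using q by simp
  qed simp
  also have "m = N \<longleftrightarrow> a + b \<in> {N, N + 1}"
    unfolding m_def by auto
  finally show ?thesis
    using av_wrap[OF assms] by (simp add: m_def)
qed

section \<open>When some average is 0\<close>

text \<open>The guard \<open>S \<noteq> {}\<close> is there because \<open>Min\<close> and
  \<open>Max\<close> of the empty set are unspecified.\<close>

definition averages_to_0 :: "nat \<Rightarrow> nat set \<Rightarrow> bool" where
  "averages_to_0 N S \<longleftrightarrow>
     {0, 1} \<subseteq> S \<or> S = {0} \<or> S \<noteq> {} \<and> Min S < Max S \<and> Min S + Max S \<in> {N, N + 1}"

lemma Bav0_eq_1_iff: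
  assumes "N \<ge> 2"
  shows "Bav0 N v = 1 \<longleftrightarrow> averages_to_0 N (supp N v)"
proof -
  define S where "S = supp N v"
  have fin: "finite S" and less: "\<And>x. x \<in> S \<Longrightarrow> x < N"
    by (auto simp: S_def supp_def ZN_def)
  have "Bav0 N v = 1 \<longleftrightarrow>
      (\<exists>k<card S. 0 = av N (supp_nth N v k) (supp_nth N v (k + 1)))"
    using assms by (simp add: Bav0_def Bav_def ZN_def S_def)
  \<comment> \<open>As \<open>k < card S\<close>, the cyclic convention of \<open>supp_nth\<close>
    can only affect the second index.\<close>
  also have "\<dots> \<longleftrightarrow> (\<exists>k<card S. 0 = av N (sorted_list_of_set S ! k)
      (sorted_list_of_set S ! (if k + 1 = card S then 0 else k + 1)))"
    by (intro ex_cong1 conj_cong) (simp_all add: supp_nth_def S_def)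
  also have "\<dots> \<longleftrightarrow> (\<exists>a b. 0 = av N a b \<and> (\<exists>k<card S. a = sorted_list_of_set S ! k \<and>
      b = sorted_list_of_set S ! (if k + 1 = card S then 0 else k + 1)))"
    by blast
  also have "\<dots> \<longleftrightarrow> (\<exists>a b. 0 = av N a b \<and> a \<in> S \<and> b \<in> S \<and>
      (a < b \<and> S \<inter> {a<..<b} = {} \<or> a = Max S \<and> b = Min S))"
    unfolding cyclically_consecutive_iff[OF fin] ..
  also have "\<dots> \<longleftrightarrow> (\<exists>a b. 0 = av N a b \<and> a \<in> S \<and> b \<in> S \<and> a < b \<and> S \<inter> {a<..<b} = {}) \<or>
      S \<noteq> {} \<and> 0 = av N (Max S) (Min S)"
    using Min_in[OF fin] Max_in[OF fin] by blast
  also have "(\<exists>a b. 0 = av N a b \<and> a \<in> S \<and> b \<in> S \<and> a < b \<and> S \<inter> {a<..<b} = {}) \<longleftrightarrow> {0, 1} \<subseteq> S"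
  proof
    assume "\<exists>a b. 0 = av N a b \<and> a \<in> S \<and> b \<in> S \<and> a < b \<and> S \<inter> {a<..<b} = {}"
    then obtain a b where ab: "0 = av N a b" "a \<in> S" "b \<in> S" "a < b"
      by blast
    \<comment> \<open>An upward step has average \<open>(a + b) div 2\<close>, which vanishes only
      for sums 0 and 1.\<close>
    then have "a + b < 2"
      using av_nowrap[of a b N] less by auto
    then have "a = 0 \<and> b = 1"
      using \<open>a < b\<close> by auto
    then show "{0, 1} \<subseteq> S"
      using ab by auto
  next
    assume "{0, 1} \<subseteq> S"
    then show "\<exists>a b. 0 = av N a b \<and> a \<in> S \<and> b \<in> S \<and> a < b \<and> S \<inter> {a<..<b} = {}"
      using assms av_nowrap[of 0 1 N] by (intro exI[of _ 0] exI[of _ 1]) auto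
  qed
  also have "S \<noteq> {} \<and> 0 = av N (Max S) (Min S) \<longleftrightarrow>
      S = {0} \<or> S \<noteq> {} \<and> Min S < Max S \<and> Min S + Max S \<in> {N, N + 1}"
  proof (cases "S = {}")
    case False
    then have le: "Min S \<le> Max S" and Max_less: "Max S < N"
      using fin less by auto
    show ?thesis
    proof (cases "Min S = Max S")
      \<comment> \<open>A singleton is averaged with itself, which returns its element.\<close>
      case True
      have "S \<subseteq> {Min S..Max S}"
        using fin by auto
      then have "S = {Max S}"
        using True False by auto
      then have "S = {0} \<longleftrightarrow> Max S = 0"
        by (metis Max_singleton)
      moreover have "av N (Max S) (Min S) = Max S"
        using av_nowrap[of "Max S" "Max S" N] True Max_less by simp
      ultimately show ?thesis
        using False True by auto
    next
      case neq: False
      then have "S \<noteq> {0}"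
        by auto
      then show ?thesis
        using av_wrap_eq_0_iff[of "Min S" "Max S" N] neq False le Max_less
        by (auto simp: add.commute)
    qed
  qed auto
  finally show ?thesis
    by (simp add: averages_to_0_def S_def)
qed

section \<open>Counting the supports\<close>

lemma card_averages_to_0:
  assumes "N \<ge> 2"
  shows "card {S. S \<subseteq> {..<N} \<and> averages_to_0 N S} = 2 ^ (N - 1)"
proof -
  define P where "P = {S. {0, 1} \<subseteq> S \<and> S \<subseteq> {..<N}}"
  \<comment> \<open>Exactly one of \<open>N\<close> and \<open>N + 1\<close> has the parity of
    \<open>t\<close>, so \<open>2 * b + t \<in> {N, N + 1}\<close> has the unique solution
    \<open>b = lo t\<close>.\<close>
  define lo where "lo t = (N + 1 - t) div 2" for t
  define W where "W t = {S. finite S \<and> S \<noteq> {} \<and> Min S = lo t \<and> Max S = lo t + t}" for t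
  have lo_pos: "lo t > 0" and hi_less: "lo t + t < N" if "t \<in> {1..N - 2}" for t
    using that by (auto simp: lo_def)
  \<comment> \<open>\<open>0 \<notin> S\<close> will separate the sets in \<open>W t\<close> from
    \<open>{0}\<close> and from the members of \<open>P\<close>.\<close>
  have W_subset: "S \<subseteq> {..<N}" and W_0: "0 \<notin> S" if "t \<in> {1..N - 2}" "S \<in> W t" for S t
  proof -
    have S: "finite S" "Min S = lo t" "Max S = lo t + t"
      using that(2) by (auto simp: W_def)
    then have "S \<subseteq> {lo t..lo t + t}"
      by (metis Max_ge Min_le atLeastAtMost_iff subsetI)
    then show "S \<subseteq> {..<N}" "0 \<notin> S"
      using lo_pos[OF that(1)] hi_less[OF that(1)] by force+
  qed
  have card_W: "card (W t) = 2 ^ (t - 1)" if "t \<in> {1..N - 2}" for t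
    unfolding W_def using that by (subst card_sets_with_Min_Max) auto
  have split: "{S. S \<subseteq> {..<N} \<and> averages_to_0 N S} = P \<union> {{0}} \<union> (\<Union>t\<in>{1..N - 2}. W t)"
  proof (intro equalityI subsetI)
    fix S
    assume S: "S \<in> {S. S \<subseteq> {..<N} \<and> averages_to_0 N S}"
    then have fin: "finite S"
      using finite_subset by blast
    show "S \<in> P \<union> {{0}} \<union> (\<Union>t\<in>{1..N - 2}. W t)"
    proof (cases "{0, 1} \<subseteq> S \<or> S = {0}")
      case False
      then have ne: "S \<noteq> {}" and lt: "Min S < Max S" and sum: "Min S + Max S \<in> {N, N + 1}"
        using S by (auto simp: averages_to_0_def)
      have "Max S < N"
        using Max_in[OF fin ne] S by auto
      \<comment> \<open>A sum of at least \<open>N\<close> with \<open>Max S < N\<close> forces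
        \<open>Min S \<ge> 1\<close>, hence the upper bound \<open>N - 2\<close>.\<close>
      then have "Max S - Min S \<in> {1..N - 2}"
        using lt sum by auto
      moreover have "S \<in> W (Max S - Min S)"
        using fin ne lt sum by (auto simp: W_def lo_def)
      ultimately show ?thesis
        by blast
    qed (use S in \<open>auto simp: P_def\<close>)
  next
    fix S
    assume "S \<in> P \<union> {{0}} \<union> (\<Union>t\<in>{1..N - 2}. W t)"
    then consider "S \<in> P" | "S = {0}" | t where "t \<in> {1..N - 2}" "S \<in> W t"
      by blast
    then show "S \<in> {S. S \<subseteq> {..<N} \<and> averages_to_0 N S}"
    proof cases
      case 3
      then have "Min S + Max S = 2 * lo t + t"
        by (auto simp: W_def)
      also have "\<dots> \<in> {N, N + 1}"
        using 3(1) unfolding lo_def atLeastAtMost_iff insert_iff empty_iff by presburger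
      finally have "averages_to_0 N S"
        using 3 unfolding averages_to_0_def by (auto simp: W_def)
      then show ?thesis
        using W_subset[OF 3] by auto
    qed (use assms in \<open>auto simp: P_def averages_to_0_def\<close>)
  qed
  have fin_W: "finite (W t)" if "t \<in> {1..N - 2}" for t
    using W_subset[OF that] finite_subset[of "W t" "Pow {..<N}"] by auto
  have fin_P: "finite P"
    by (rule finite_subset[of _ "Pow {..<N}"]) (auto simp: P_def)
  \<comment> \<open>The sets \<open>W t\<close> are disjoint since \<open>t\<close> is recovered as
    \<open>Max S - Min S\<close>.\<close>
  have "card (\<Union>t\<in>{1..N - 2}. W t) = (\<Sum>t=1..N - 2. card (W t))"
    using fin_W by (intro card_UN_disjoint) (auto simp: W_def)
  also have "\<dots> = (\<Sum>t=1..N - 2. 2 ^ (t - 1))"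
    using card_W by simp
  also have "\<dots> = (\<Sum>t<N - 2. 2 ^ t)"
    by (rule sum.reindex_bij_witness[of _ Suc "\<lambda>t. t - 1"]) auto
  also have "\<dots> = 2 ^ (N - 2) - 1"
    by (simp add: mask_eq_sum_exp_nat lessThan_def)
  finally have card_UN: "card (\<Union>t\<in>{1..N - 2}. W t) = 2 ^ (N - 2) - 1" .
  have "card P = 2 ^ (N - 2)"
  proof -
    have "card P = 2 ^ card ({..<N} - {0, 1})"
      unfolding P_def by (rule card_between_sets) (use assms in auto)
    also have "card ({..<N} - {0, 1}) = N - 2"
      using assms by (subst card_Diff_subset) auto
    finally show ?thesis .
  qed
  moreover have "card (P \<union> {{0}}) = card P + 1"
    using fin_P by (subst card_Un_disjoint) (auto simp: P_def)
  moreover have "card (P \<union> {{0}} \<union> (\<Union>t\<in>{1..N - 2}. W t)) =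
      card (P \<union> {{0}}) + card (\<Union>t\<in>{1..N - 2}. W t)"
  proof (rule card_Un_disjoint)
    show "(P \<union> {{0}}) \<inter> (\<Union>t\<in>{1..N - 2}. W t) = {}"
      using W_0 by (fastforce simp: P_def)
  qed (use fin_P fin_W in auto)
  \<comment> \<open>The set \<open>{0}\<close> makes up for the 1 missing from the geometric sum;
    \<open>one_le_power\<close> keeps the truncated subtraction exact.\<close>
  ultimately have "card {S. S \<subseteq> {..<N} \<and> averages_to_0 N S} = 2 * 2 ^ (N - 2)"
    using one_le_power[of "2 :: nat" "N - 2"] unfolding split card_UN by linarith
  also have "\<dots> = 2 ^ Suc (N - 2)"
    by simp
  also have "Suc (N - 2) = N - 1"
    using assms by simp
  finally show ?thesis .
qed

theorem theorem5p1:
  fixes N :: nat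
  assumes "N \<ge> 3"
  shows "balanced N (Bav0 N)"
proof -
  have ones: "card {v \<in> F2_vec N. Bav0 N v = 1} = 2 ^ (N - 1)"
    using assms by (simp add: Bav0_eq_1_iff card_F2_vec_supp card_averages_to_0)
  have card_all: "card (F2_vec N) = 2 ^ N"
    using bij_betw_same_card[OF bij_betw_supp[of N]] by (simp add: card_Pow)
  \<comment> \<open>An infinite set would have \<open>card\<close> 0, which is not a power of
    2.\<close>
  then have fin: "finite (F2_vec N)"
    using card.infinite by fastforce
  have "{v \<in> F2_vec N. Bav0 N v = 0} = F2_vec N - {v \<in> F2_vec N. Bav0 N v = 1}"
    by auto
  then have "card {v \<in> F2_vec N. Bav0 N v = 0} = 2 ^ N - 2 ^ (N - 1)"
    using fin by (simp add: card_Diff_subset ones card_all)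
  also have "\<dots> = 2 ^ (N - 1)"
    using assms by (cases N) auto
  finally show ?thesis
    using ones by (simp add: balanced_def)
qed

end
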